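(* Let $G$ be the graph with vertex set $\{u,v,p_u^1,p_u^2,p_v,q_2,q_3\}\cup P\cup Q$ with $|P|=|Q|=6$ (all listed vertices distinct, $P$ and $Q$ disjoint from each other and from the rest), together with a bijection $q\mapsto p_q$ from $Q$ to $P$, and with exactly the following edges: $uv$, $up_u^1$, $up_u^2$, $vp_v$, $p_u^1q_2$, $q_2p_v$, $p_u^2q_3$, $q_3p_v$, and, for every $q\in Q$, the edges $p_u^1q$, $qp_q$ and $p_qv$. Then $W_{BM}(u,v)=37/24$. On the other hand, the map $x:G\to\mathbb{R}$ given by $$x(a)=\begin{cases}1, & a=p_u^2,\\ 0, & a\in\{u,p_u^1,q_3\},\\ -1, & a\in\{v,p_v,q_2\}\cup Q,\\ -2, & a\in P\end{cases}$$ is Lipschitz and has transport profit $W_{uv}(x)=13/8>37/24$, i.e. $W_{uv}(x)>W_{BM}(u,v)$.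
   Context: Graphs are simple, locally finite and unweighted; $\rho$ is the geodesic graph distance. $N(w)$ is the set of neighbours of a vertex $w$, $d_w=|N(w)|$, $m_w=1/d_w$. A map $x:G\to\mathbb{R}$ on the vertices is Lipschitz if $|x(a)-x(b)|\le\rho(a,b)$ for all vertices $a,b$. For an edge $uv$ the transport profit of $x$ is $W_{uv}(x)=m_u\sum_{a\in N(u)}x(a)-m_v\sum_{b\in N(v)}x(b)$. Write $\alpha\lor\beta=\max(\alpha,\beta)$ and $[\alpha]_+=\max(\alpha,0)$. For an edge $uv$ and $(a,b)\in\{(u,v),(v,u)\}$: $\triangle(uv)=N(u)\cap N(v)$; $\square(a)\subseteq N(a)\setminus\{b\}$ is the set of neighbours of $a$ (other than $b$) lying on a 4-cycle containing the edge $uv$ but on no 3-cycle containing $uv$; $\mathrm{Pent}(a)\subseteq N(a)\setminus\{b\}$ is the set of those lying on a 5-cycle containing the edge $uv$ but on no 3- or 4-cycle containing $uv$; $\mathrm{Pent}(u,v)$ is the set of vertices at distance exactly 2 from both $u$ and $v$. Let $R=\triangle(uv)\cup\square(u)\cup\square(v)\cup\mathrm{Pent}(u)\cup\mathrm{Pent}(v)\cup\mathrm{Pent}(u,v)$, and let $R_1,\dots,R_K$ be the connected components of the subgraph of $G$ induced by $R$. Put $\mathrm{Pent}_a=|\mathrm{Pent}(a)|$ and $\mathrm{Pent}_a^k=|R_k\cap\mathrm{Pent}(a)|$. For an edge $uv$ of a graph of girth greater than 4 define $$W_{BM}(u,v)=1+[1-m_u-m_v]_+ +\Big[1-m_u-m_v-m_u\mathrm{Pent}_u-m_v\mathrm{Pent}_v+\sum_{k=1}^K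 (m_u\mathrm{Pent}_u^k)\lor(m_v\mathrm{Pent}_v^k)\Big]_+ .$$ *)

theory Defs
  imports
    "Graph_Theory.Pair_Digraph"
    "Graph_Theory.Digraph_Component"
    "Graph_Theory.Shortest_Path"
    "HOL-Library.Extended_Nat"
begin

text \<open>
  Undirected simple graphs are loop-free symmetric digraphs whose arcs are pairs: an edge \<open>ab\<close>
  is the pair of opposite arcs \<open>(a, b)\<close>, \<open>(b, a)\<close>. The vertex set may be infinite.
\<close>

locale locally_finite_graph = pair_bidirected_digraph +
  assumes locally_finite: "a \<in> pverts G \<Longrightarrow> finite (out_arcs G a)"
begin

definition nbrs :: "'a \<Rightarrow> 'a set" where
  "nbrs w = {a. (w, a) \<in> parcs G}"

definition mass :: "'a \<Rightarrow> real" where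
  "mass w = 1 / real (card (nbrs w))"

text \<open>The distance of vertices in different components is \<open>\<infinity>\<close>.\<close>

definition rho :: "'a \<Rightarrow> 'a \<Rightarrow> ereal" where
  "rho a b = \<mu> (\<lambda>_. 1) a b"

definition lipschitz :: "('a \<Rightarrow> real) \<Rightarrow> bool" where
  "lipschitz x \<longleftrightarrow> (\<forall>a\<in>pverts G. \<forall>b\<in>pverts G. ereal \<bar>x a - x b\<bar> \<le> rho a b)"

definition transport_profit :: "('a \<Rightarrow> real) \<Rightarrow> 'a \<Rightarrow> 'a \<Rightarrow> real" where
  "transport_profit x u v = mass u * (\<Sum>a\<in>nbrs u. x a) - mass v * (\<Sum>b\<in>nbrs v. x b)"

text \<open>
  The library's \<^const>\<open>pre_digraph.cycle\<close> is a closed walk, given as a list of arcs, without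
  repeated vertices; it also admits the closed walk of length 2 along a single edge, which is
  not a cycle of the undirected graph. Hence the bound on the length below.
\<close>

definition girth :: enat where
  "girth = (INF p\<in>{p. cycle p \<and> 3 \<le> length p}. enat (length p))"

text \<open>The vertex \<open>w\<close> lies on a \<open>k\<close>-cycle (\<open>k \<ge> 3\<close>) containing the edge \<open>ab\<close>.\<close>

definition on_cycle_through :: "nat \<Rightarrow> 'a \<Rightarrow> 'a \<Rightarrow> 'a \<Rightarrow> bool" where
  "on_cycle_through k a b w \<longleftrightarrow>
     (\<exists>p. cycle p \<and> length p = k \<and> ((a, b) \<in> set p \<or> (b, a) \<in> set p) \<and> w \<in> fst ` set p)"

definition triangle :: "'a \<Rightarrow> 'a \<Rightarrow> 'a set" where
  "triangle u v = nbrs u \<inter> nbrs v"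

text \<open>
  \<open>square a b\<close> and \<open>pent a b\<close> are \<open>\<box>(a)\<close> and \<open>Pent(a)\<close> for the edge \<open>ab\<close>;
  \<open>pent_common u v\<close> is \<open>Pent(u, v)\<close>.
\<close>

definition square :: "'a \<Rightarrow> 'a \<Rightarrow> 'a set" where
  "square a b = {w \<in> nbrs a - {b}. on_cycle_through 4 a b w \<and> \<not> on_cycle_through 3 a b w}"

definition pent :: "'a \<Rightarrow> 'a \<Rightarrow> 'a set" where
  "pent a b = {w \<in> nbrs a - {b}. on_cycle_through 5 a b w
     \<and> \<not> on_cycle_through 3 a b w \<and> \<not> on_cycle_through 4 a b w}"

definition pent_common :: "'a \<Rightarrow> 'a \<Rightarrow> 'a set" where
  "pent_common u v = {w \<in> pverts G. rho u w = 2 \<and> rho v w = 2}"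

definition core_nbhd :: "'a \<Rightarrow> 'a \<Rightarrow> 'a set" where
  "core_nbhd u v = triangle u v \<union> square u v \<union> square v u \<union> pent u v \<union> pent v u \<union> pent_common u v"

text \<open>
  Vertex sets of the connected components \<open>R\<^sub>1, \<dots>, R\<^sub>K\<close>: since the graph is symmetric, these are
  the strongly connected components of the induced sub-digraph.
\<close>

definition core_components :: "'a \<Rightarrow> 'a \<Rightarrow> 'a set set" where
  "core_components u v = pre_digraph.sccs_verts (with_proj G \<restriction> core_nbhd u v)"

definition W_BM :: "'a \<Rightarrow> 'a \<Rightarrow> real" where
  "W_BM u v =
     1 + max (1 - mass u - mass v) 0
       + max (1 - mass u - mass v
              - mass u * real (card (pent u v)) - mass v * real (card (pent v u))
              + (\<Sum>C\<in>core_components u v.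
                   max (mass u * real (card (C \<inter> pent u v)))
                       (mass v * real (card (C \<inter> pent v u))))) 0"

end

end

(* The graph has girth 5, so there are no triangles or squares at uv and only 5-cycles matter.
   Every neighbour of u or v lies on one, and R consists of all vertices other than u and v.
   R stays connected because Q and q2 are joined to pu1, and pu2 is reached along q2, pv, q3.
   With a single component, the maximum over it is 7/8 and the last bracket is
   [13/24 - 2/3 - 7/8 + 7/8]_+ = 0, whence W_BM = 1 + 13/24. *)

theory Submission
  imports Defs
begin

text \<open>All vertices reach each other, so the component of any vertex is the whole vertex set.
  Nonemptiness, part of \<open>strongly_connected\<close>, guarantees that this component
  occurs.\<close>

lemma sccs_verts_strongly_connected:
  assumes "wf_digraph H" "strongly_connected H"
  shows "pre_digraph.sccs_verts H = {verts H}"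
proof -
  interpret wf_digraph H by fact
  have "scc_of a = verts H" if "a \<in> verts H" for a
    using that assms(2) by (auto simp: scc_of_def strongly_connected_def dest: reachable_in_verts)
  then show ?thesis
    using assms(2) by (auto simp: sccs_verts_conv_scc_of strongly_connected_def)
qed

section \<open>Distances and Lipschitz maps in a locally finite graph\<close>

context locally_finite_graph
begin

lemma awalk_cost_one: "awalk_cost (\<lambda>_. 1) w = real (length w)"
  by (induct w) (auto simp: awalk_cost_def)

lemma rho_le_length: "awalk a w b \<Longrightarrow> rho a b \<le> ereal (real (length w))"
  unfolding rho_def using min_cost_le_walk_cost[of a w b "\<lambda>_. 1"] by (simp add: awalk_cost_one)

lemma rho_greatest:
  assumes "\<And>w. awalk a w b \<Longrightarrow> c \<le> ereal (real (length w))"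
  shows "c \<le> rho a b"
  unfolding rho_def \<mu>_def using assms by (auto intro!: INF_greatest simp: awalk_cost_one)

lemma awalk_length_1: "awalk a w b \<Longrightarrow> length w = 1 \<Longrightarrow> (a, b) \<in> parcs G"
  by (cases w) (auto simp: awalk_def)

lemma awalk_length_2:
  assumes "awalk a w b" "length w = 2"
  obtains c where "(a, c) \<in> parcs G" "(c, b) \<in> parcs G"
  using assms by (auto simp: awalk_def length_Suc_conv numeral_2_eq_2)

text \<open>Inequality and non-adjacency rule out walks of length 0 and 1, and a middle vertex
  supplies one of length 2. This lets \<open>pent_common\<close> be read off neighbour sets.\<close>

lemma rho_eq_2_iff:
  "rho a b = 2 \<longleftrightarrow> a \<noteq> b \<and> (a, b) \<notin> parcs G \<and> (\<exists>c. (a, c) \<in> parcs G \<and> (c, b) \<in> parcs G)"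
proof
  assume r: "rho a b = 2"
  \<comment> \<open>If every walk had at least 3 arcs, or none existed, the infimum of the lengths
    would be at least 3.\<close>
  have "\<exists>w. awalk a w b \<and> length w < 3"
  proof (rule ccontr)
    assume "\<not> ?thesis"
    then have "ereal 3 \<le> rho a b"
      by (intro rho_greatest) (auto simp: not_less)
    then show False using r by simp
  qed
  then obtain w where w: "awalk a w b" "length w < 3" by blast
  have "2 \<le> length w" using rho_le_length[OF w(1)] r
    by (metis ereal_less_eq(3) numeral_eq_ereal of_nat_le_iff of_nat_numeral)
  with w have l2: "length w = 2" by simp
  \<comment> \<open>If \<open>a = b\<close>, the empty walk would give distance 0; that
    \<open>a\<close> is a vertex comes from \<open>w\<close>.\<close>
  have "a \<noteq> b"
    using rho_le_length[of a "[]" b] r awalk_hd_in_verts[OF w(1)] by (auto simp: awalk_Nil_iff)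
  moreover have "(a, b) \<notin> parcs G"
    using rho_le_length[of a "[(a, b)]" b] r by (auto simp: awalk_def dest: in_arcsD1)
  ultimately show "a \<noteq> b \<and> (a, b) \<notin> parcs G \<and> (\<exists>c. (a, c) \<in> parcs G \<and> (c, b) \<in> parcs G)"
    using awalk_length_2[OF w(1) l2] by blast
next
  assume r: "a \<noteq> b \<and> (a, b) \<notin> parcs G \<and> (\<exists>c. (a, c) \<in> parcs G \<and> (c, b) \<in> parcs G)"
  then obtain c where c: "(a, c) \<in> parcs G" "(c, b) \<in> parcs G" by blast
  have "rho a b \<le> 2"
    using rho_le_length[of a "[(a, c), (c, b)]" b] c by (auto simp: awalk_def dest: in_arcsD1)
  moreover have "2 \<le> rho a b"
  proof (rule rho_greatest)
    fix w assume w: "awalk a w b"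
    have "length w \<noteq> 0" using w r by (auto simp: awalk_Nil_iff)
    moreover have "length w \<noteq> 1" using w r awalk_length_1 by blast
    ultimately have "2 \<le> length w" by linarith
    then show "2 \<le> ereal (real (length w))"
      by (metis ereal_less_eq(3) numeral_eq_ereal of_nat_le_iff of_nat_numeral)
  qed
  ultimately show "rho a b = 2" by (rule antisym)
qed

text \<open>The changes along a walk add up to at most its length. Pairs joined by no walk are at
  infinite distance and impose nothing.\<close>

lemma lipschitzI:
  assumes "\<And>a b. (a, b) \<in> parcs G \<Longrightarrow> \<bar>x a - x b\<bar> \<le> 1"
  shows "lipschitz x"
proof -
  have walk: "\<bar>x a - x b\<bar> \<le> real (length w)" if "awalk a w b" for a b w
    using that
  proof (induct w arbitrary: a)
    case Nil
    then show ?case by (simp add: awalk_Nil_iff)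
  next
    case (Cons e w)
    then have "\<bar>x (snd e) - x b\<bar> \<le> real (length w)" "fst e = a" "e \<in> parcs G"
      by (auto simp: awalk_Cons_iff)
    with assms[of a "snd e"] show ?case by (cases e) auto
  qed
  then show ?thesis by (auto simp: lipschitz_def intro!: rho_greatest)
qed

section \<open>Short cycles and girth\<close>

lemma cycle_length_3E:
  assumes "cycle w" "length w = 3"
  obtains a b c where "(a, b) \<in> parcs G" "(b, c) \<in> parcs G" "(c, a) \<in> parcs G"
  using assms by (auto simp: cycle_def awalk_def length_Suc_conv numeral_3_eq_3)

lemma cycle_length_4E:
  assumes "cycle w" "length w = 4"
  obtains a b c d where "(a, b) \<in> parcs G" "(b, c) \<in> parcs G" "(c, d) \<in> parcs G" "(d, a) \<in> parcs G"
    "a \<noteq> c" "b \<noteq> d"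
  using assms by (auto simp: cycle_def awalk_def length_Suc_conv eval_nat_numeral)

text \<open>A 3-cycle yields two adjacent neighbours of a vertex, a 4-cycle two vertices with a
  second common neighbour. Both conditions are local and can be checked by cases on
  \<open>a\<close>.\<close>

lemma girth_gt_4I:
  assumes tri: "\<And>a b c. b \<in> nbrs a \<Longrightarrow> c \<in> nbrs a \<Longrightarrow> c \<notin> nbrs b"
    and quad: "\<And>a b c d. \<lbrakk>b \<in> nbrs a; d \<in> nbrs a; b \<noteq> d; c \<in> nbrs b; c \<in> nbrs d\<rbrakk> \<Longrightarrow> c = a"
  shows "4 < girth"
proof -
  have "5 \<le> length w" if w: "cycle w" "3 \<le> length w" for w
  proof -
    have "length w \<noteq> 3"
    proof
      assume "length w = 3"
      from cycle_length_3E[OF w(1) this] show False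
        using tri by (metis arcs_symmetric mem_Collect_eq nbrs_def)
    qed
    moreover have "length w \<noteq> 4"
    proof
      assume "length w = 4"
      from cycle_length_4E[OF w(1) this] show False
        using quad by (metis arcs_symmetric mem_Collect_eq nbrs_def)
    qed
    ultimately show ?thesis using w(2) by linarith
  qed
  then have "5 \<le> girth" unfolding girth_def
    by (intro INF_greatest) (metis (mono_tags) enat_ord_simps(1) mem_Collect_eq numeral_eq_enat)
  then show ?thesis by (rule less_le_trans[rotated]) simp
qed

text \<open>Such a cycle would bound the girth by \<open>k\<close>; since \<open>3 \<le> k\<close>,
  it is among the closed walks that \<open>girth\<close> counts.\<close>

lemma not_on_cycle_through_below_girth:
  assumes "enat k < girth" "3 \<le> k"
  shows "\<not> on_cycle_through k a b w"
proof
  assume "on_cycle_through k a b w"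
  then obtain c where "cycle c" "length c = k" by (auto simp: on_cycle_through_def)
  with assms(2) have "girth \<le> enat k" unfolding girth_def by (auto intro: INF_lower2)
  with assms(1) show False by simp
qed

lemma on_cycle_through_swap: "on_cycle_through k a b w \<longleftrightarrow> on_cycle_through k b a w"
  by (auto simp: on_cycle_through_def)

text \<open>On the cycle a, b, c, d, e the vertex \<open>e\<close> is the other neighbour of
  \<open>a\<close>, and \<open>c\<close> that of \<open>b\<close>, so one cycle serves both ends of
  the edge.\<close>

lemma on_5_cycleI:
  assumes "(a, b) \<in> parcs G" "(b, c) \<in> parcs G" "(c, d) \<in> parcs G" "(d, e) \<in> parcs G"
    "(e, a) \<in> parcs G" "distinct [a, b, c, d, e]"
  shows "on_cycle_through 5 a b e" "on_cycle_through 5 a b c"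
proof -
  let ?w = "[(a, b), (b, c), (c, d), (d, e), (e, a)]"
  have "awalk a ?w a" using assms by (auto simp: awalk_def dest: in_arcsD1)
  then have "cycle ?w" using assms(6) unfolding cycle_def by (intro exI[of _ a]) auto
  then show "on_cycle_through 5 a b e" "on_cycle_through 5 a b c"
    unfolding on_cycle_through_def by (force intro!: exI[of _ ?w])+
qed

lemma triangle_empty:
  assumes "4 < girth" "(a, b) \<in> parcs G"
  shows "triangle a b = {}"
proof (rule ccontr)
  assume "triangle a b \<noteq> {}"
  then obtain c where c: "(a, c) \<in> parcs G" "(b, c) \<in> parcs G"
    by (auto simp: triangle_def nbrs_def)
  let ?w = "[(a, b), (b, c), (c, a)]"
  have "awalk a ?w a" using assms(2) c by (auto simp: awalk_def dest: in_arcsD1 arcs_symmetric)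
  \<comment> \<open>The three vertices are distinct because adjacent vertices differ.\<close>
  then have "cycle ?w"
    using assms(2) c unfolding cycle_def by (intro exI[of _ a]) (auto dest: pair_no_loops)
  then have "on_cycle_through 3 a b c"
    unfolding on_cycle_through_def by (force intro!: exI[of _ ?w])
  moreover have "enat 3 < girth" using assms(1) by (rule less_trans[rotated]) (simp add: numeral_eq_enat)
  ultimately show False using not_on_cycle_through_below_girth[of 3] by simp
qed

lemma square_empty: "4 < girth \<Longrightarrow> square a b = {}"
  using not_on_cycle_through_below_girth[of 4] by (auto simp: square_def numeral_eq_enat)

lemma pent_girth_gt_4:
  assumes "4 < girth"
  shows "pent a b = {w \<in> nbrs a - {b}. on_cycle_through 5 a b w}"
proof -
  have "enat 3 < girth" "enat 4 < girth"
    using assms by (auto simp: numeral_eq_enat intro: less_trans[rotated])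
  then show ?thesis using not_on_cycle_through_below_girth by (auto simp: pent_def)
qed

section \<open>Connectedness of the core neighbourhood\<close>

text \<open>Symmetry passes to the induced subgraph, so walks from the root \<open>r\<close> can be
  reversed and any two vertices are joined through \<open>r\<close>.\<close>

lemma core_components_connected:
  assumes "r \<in> core_nbhd u v"
    and "\<And>a. a \<in> core_nbhd u v \<Longrightarrow> r \<rightarrow>\<^sup>*\<^bsub>with_proj G \<restriction> core_nbhd u v\<^esub> a"
  shows "core_components u v = {core_nbhd u v}"
proof -
  let ?H = "with_proj G \<restriction> core_nbhd u v"
  interpret H: wf_digraph ?H by (rule wellformed_induce_subgraph)
  have "symmetric ?H"
    by (auto simp: symmetric_def sym_def arcs_ends_conv induce_subgraph_def image_iff
        dest: arcs_symmetric)
  then have "strongly_connected ?H"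
    using assms unfolding strongly_connected_def
    by (auto intro: H.reachable_trans symmetric_reachable)
  then show ?thesis
    unfolding core_components_def
    by (subst sccs_verts_strongly_connected[OF H.wf_digraph_axioms]) simp_all
qed

end

section \<open>The graph of the counterexample\<close>

locale BM_counterexample =
  fixes G :: "'a pair_pre_digraph"
    and u v pu1 pu2 pv q2 q3 :: 'a
    and P Q :: "'a set"
    and p :: "'a \<Rightarrow> 'a"
    and E :: "('a \<times> 'a) set"
  assumes dist: "distinct [u, v, pu1, pu2, pv, q2, q3]"
    and card_P: "card P = 6" and card_Q: "card Q = 6" and PQ_disj: "P \<inter> Q = {}"
    and PQ_fresh: "(P \<union> Q) \<inter> {u, v, pu1, pu2, pv, q2, q3} = {}"
    and p_bij: "bij_betw p Q P"
    and verts_G: "pverts G = {u, v, pu1, pu2, pv, q2, q3} \<union> P \<union> Q"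
    and E_eq: "E = {(u, v), (u, pu1), (u, pu2), (v, pv), (pu1, q2), (q2, pv), (pu2, q3), (q3, pv)}
               \<union> (\<Union>q\<in>Q. {(pu1, q), (q, p q), (p q, v)})"
    and arcs_G: "parcs G = E \<union> E\<inverse>"
begin

lemma finite_PQ [simp]: "finite P" "finite Q"
  using card_P card_Q by (auto intro: card_ge_0_finite)

text \<open>Both orientations are listed, so that the simplifier decides every equation between the
  seven named vertices.\<close>

lemma distinct_consts [simp]:
  "u \<noteq> v" "u \<noteq> pu1" "u \<noteq> pu2" "u \<noteq> pv" "u \<noteq> q2" "u \<noteq> q3"
  "v \<noteq> u" "v \<noteq> pu1" "v \<noteq> pu2" "v \<noteq> pv" "v \<noteq> q2" "v \<noteq> q3"
  "pu1 \<noteq> u" "pu1 \<noteq> v" "pu1 \<noteq> pu2" "pu1 \<noteq> pv" "pu1 \<noteq> q2" "pu1 \<noteq> q3"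
  "pu2 \<noteq> u" "pu2 \<noteq> v" "pu2 \<noteq> pu1" "pu2 \<noteq> pv" "pu2 \<noteq> q2" "pu2 \<noteq> q3"
  "pv \<noteq> u" "pv \<noteq> v" "pv \<noteq> pu1" "pv \<noteq> pu2" "pv \<noteq> q2" "pv \<noteq> q3"
  "q2 \<noteq> u" "q2 \<noteq> v" "q2 \<noteq> pu1" "q2 \<noteq> pu2" "q2 \<noteq> pv" "q2 \<noteq> q3"
  "q3 \<noteq> u" "q3 \<noteq> v" "q3 \<noteq> pu1" "q3 \<noteq> pu2" "q3 \<noteq> pv" "q3 \<noteq> q2"
  using dist by auto

lemma consts_notin_PQ [simp]:
  "u \<notin> P" "v \<notin> P" "pu1 \<notin> P" "pu2 \<notin> P" "pv \<notin> P" "q2 \<notin> P" "q3 \<notin> P"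
  "u \<notin> Q" "v \<notin> Q" "pu1 \<notin> Q" "pu2 \<notin> Q" "pv \<notin> Q" "q2 \<notin> Q" "q3 \<notin> Q"
  using PQ_fresh by auto

lemma Q_notin_P [simp]: "a \<in> Q \<Longrightarrow> a \<notin> P"
  using PQ_disj by auto

lemma P_eq_image: "P = p ` Q"
  using p_bij by (simp add: bij_betw_def)

lemma p_in_P [simp]: "q \<in> Q \<Longrightarrow> p q \<in> P"
  by (simp add: P_eq_image)

lemma p_notin_Q [simp]: "q \<in> Q \<Longrightarrow> p q \<notin> Q"
  using Q_notin_P p_in_P by blast

lemma p_eq_iff [simp]: "q \<in> Q \<Longrightarrow> q' \<in> Q \<Longrightarrow> p q = p q' \<longleftrightarrow> q = q'"
  using p_bij by (auto simp: bij_betw_def inj_on_def)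

lemma p_neq [simp]:
  assumes "q \<in> Q"
  shows "p q \<noteq> u" "p q \<noteq> v" "p q \<noteq> pu1" "p q \<noteq> pu2" "p q \<noteq> pv" "p q \<noteq> q2" "p q \<noteq> q3"
    "u \<noteq> p q" "v \<noteq> p q" "pu1 \<noteq> p q" "pu2 \<noteq> p q" "pv \<noteq> p q" "q2 \<noteq> p q" "q3 \<noteq> p q"
  using p_in_P[OF assms] by (metis consts_notin_PQ)+

lemma Q_neq [simp]:
  assumes "q \<in> Q"
  shows "q \<noteq> u" "q \<noteq> v" "q \<noteq> pu1" "q \<noteq> pu2" "q \<noteq> pv" "q \<noteq> q2" "q \<noteq> q3"
    "u \<noteq> q" "v \<noteq> q" "pu1 \<noteq> q" "pu2 \<noteq> q" "pv \<noteq> q" "q2 \<noteq> q" "q3 \<noteq> q"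
    "q' \<in> Q \<Longrightarrow> p q' \<noteq> q" "q' \<in> Q \<Longrightarrow> q \<noteq> p q'"
  using assms consts_notin_PQ(8-14) p_notin_Q by metis+

lemma finite_arcs_G: "finite (parcs G)"
  by (simp add: arcs_G E_eq)

sublocale locally_finite_graph G
proof
  show "fst e \<in> pverts G" "snd e \<in> pverts G" if "e \<in> parcs G" for e
    using that unfolding arcs_G E_eq verts_G by auto
  show "symmetric (with_proj G)"
    by (auto simp: symmetric_def arcs_G sym_def)
  show "fst e \<noteq> snd e" if "e \<in> parcs G" for e
    using that unfolding arcs_G E_eq by auto
  show "finite (out_arcs (with_proj G) a)" for a
    using finite_arcs_G by (auto simp: out_arcs_def)
qed

lemma nbrs_eqs:
  "nbrs u = {v, pu1, pu2}" "nbrs v = {u, pv} \<union> P" "nbrs pu1 = {u, q2} \<union> Q"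
  "nbrs pu2 = {u, q3}" "nbrs pv = {v, q2, q3}" "nbrs q2 = {pu1, pv}" "nbrs q3 = {pu2, pv}"
  by (auto simp: nbrs_def arcs_G E_eq P_eq_image)

lemma nbrs_Q: "q \<in> Q \<Longrightarrow> nbrs q = {pu1, p q}"
  unfolding nbrs_def arcs_G E_eq by (intro equalityI subsetI; simp; elim disjE; force)

text \<open>Injectivity of \<open>p\<close> makes \<open>q\<close> the only neighbour of
  \<open>p q\<close> in \<open>Q\<close>.\<close>

lemma nbrs_p: "q \<in> Q \<Longrightarrow> nbrs (p q) = {q, v}"
  unfolding nbrs_def arcs_G E_eq by (intro equalityI subsetI; simp; elim disjE; force)

lemma arc_iff: "(a, b) \<in> parcs G \<longleftrightarrow> b \<in> nbrs a"
  by (simp add: nbrs_def)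

text \<open>A vertex of \<open>P\<close> is presented as \<open>p q\<close>, the form to which
  \<open>nbrs_p\<close> applies.\<close>

lemma nbrs_cases:
  assumes "b \<in> nbrs a"
  obtains "a = u" | "a = v" | "a = pu1" | "a = pu2" | "a = pv" | "a = q2" | "a = q3"
  | "a \<in> Q" | q where "q \<in> Q" "a = p q"
  using in_arcsD1[of a b] assms unfolding arc_iff[symmetric] verts_G P_eq_image by auto

lemma girth_gt_4: "4 < girth"
proof (rule girth_gt_4I)
  fix a b c
  assume b: "b \<in> nbrs a" and "c \<in> nbrs a"
  then show "c \<notin> nbrs b"
    by (cases rule: nbrs_cases[OF b]) (auto simp: nbrs_eqs nbrs_Q nbrs_p P_eq_image)
next
  fix a b c d
  assume b: "b \<in> nbrs a" and "d \<in> nbrs a" "b \<noteq> d" "c \<in> nbrs b" "c \<in> nbrs d"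
  then show "c = a"
    by (cases rule: nbrs_cases[OF b]) (auto simp: nbrs_eqs nbrs_Q nbrs_p P_eq_image)
qed

section \<open>Computation of the curvature formula at the edge uv\<close>

lemma mass_eqs: "mass u = 1 / 3" "mass v = 1 / 8"
  by (simp_all add: mass_def nbrs_eqs card_P)

text \<open>Witnesses are the 5-cycles u, v, pv, q2, pu1 and u, v, pv, q3, pu2.\<close>

lemma pent_u: "pent u v = {pu1, pu2}"
proof -
  have "on_cycle_through 5 u v pu1"
    by (rule on_5_cycleI(1)[of u v pv q2]) (simp_all add: arc_iff nbrs_eqs)
  moreover have "on_cycle_through 5 u v pu2"
    by (rule on_5_cycleI(1)[of u v pv q3]) (simp_all add: arc_iff nbrs_eqs)
  ultimately show ?thesis
    by (auto simp: pent_girth_gt_4[OF girth_gt_4] nbrs_eqs)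
qed

text \<open>The cycle used for \<open>pu1\<close> also covers \<open>pv\<close>; each
  \<open>p q\<close> lies on u, v, p q, q, pu1.\<close>

lemma pent_v: "pent v u = {pv} \<union> P"
proof -
  have "on_cycle_through 5 u v pv"
    by (rule on_5_cycleI(2)[of u v pv q2 pu1]) (simp_all add: arc_iff nbrs_eqs)
  moreover have "on_cycle_through 5 u v (p q)" if "q \<in> Q" for q
    using that
    by (intro on_5_cycleI(2)[of u v "p q" q pu1]) (auto simp: arc_iff nbrs_eqs nbrs_Q nbrs_p)
  ultimately show ?thesis
    by (auto simp: pent_girth_gt_4[OF girth_gt_4] nbrs_eqs P_eq_image on_cycle_through_swap[of 5 v])
qed

lemma pent_common_uv: "pent_common u v = {q2, q3} \<union> Q"
proof -
  \<comment> \<open>Distance 2 from both ends means being a second neighbour of each without being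
    an end or adjacent to one. Thus \<open>pv\<close> and \<open>P\<close>, at distance 2 from
    \<open>u\<close>, drop out as neighbours of \<open>v\<close>.\<close>
  have "pent_common u v = {w \<in> pverts G. w \<notin> {u, v} \<union> nbrs u \<union> nbrs v
      \<and> w \<in> (\<Union>c\<in>nbrs u. nbrs c) \<and> w \<in> (\<Union>c\<in>nbrs v. nbrs c)}"
    unfolding pent_common_def rho_eq_2_iff arc_iff by blast
  moreover have "(\<Union>c\<in>nbrs u. nbrs c) = {u, pv, q2, q3} \<union> P \<union> Q"
    by (auto simp: nbrs_eqs)
  moreover have "(\<Union>c\<in>nbrs v. nbrs c) = {v, pu1, pu2, q2, q3} \<union> Q"
    by (auto simp: nbrs_eqs nbrs_p P_eq_image)
  ultimately have "pent_common u v = {w \<in> {u, v, pu1, pu2, pv, q2, q3} \<union> P \<union> Q.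
      w \<notin> {u, v} \<union> {v, pu1, pu2} \<union> ({u, pv} \<union> P)
      \<and> w \<in> {u, pv, q2, q3} \<union> P \<union> Q \<and> w \<in> {v, pu1, pu2, q2, q3} \<union> Q}"
    by (simp only: nbrs_eqs verts_G)
  also have "\<dots> = {q2, q3} \<union> Q"
    by (intro set_eqI iffI; simp; elim disjE conjE; simp)
  finally show ?thesis .
qed

lemma core_nbhd_uv: "core_nbhd u v = {pu1, pu2, pv, q2, q3} \<union> P \<union> Q"
proof -
  have "triangle u v = {}"
    by (rule triangle_empty[OF girth_gt_4]) (simp add: arc_iff nbrs_eqs)
  then show ?thesis
    unfolding core_nbhd_def square_empty[OF girth_gt_4] pent_u pent_v pent_common_uv by blast
qed

lemma core_components_uv: "core_components u v = {core_nbhd u v}"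
proof (rule core_components_connected)
  let ?H = "with_proj G \<restriction> core_nbhd u v"
  show "pu1 \<in> core_nbhd u v" by (simp add: core_nbhd_uv)
  interpret H: wf_digraph ?H by (rule wellformed_induce_subgraph)
  \<comment> \<open>Reachability inside the core extends to any neighbour in the core, since a
    reached vertex is itself in the core.\<close>
  have step: "pu1 \<rightarrow>\<^sup>*\<^bsub>?H\<^esub> b" if "pu1 \<rightarrow>\<^sup>*\<^bsub>?H\<^esub> a" "b \<in> nbrs a" "b \<in> core_nbhd u v" for a b
  proof -
    have "a \<in> core_nbhd u v" using H.reachable_in_verts(2)[OF that(1)] by simp
    then have "(a, b) \<in> arcs_ends ?H"
      using that by (force simp: arcs_ends_conv induce_subgraph_def arc_iff)
    with that(1) show ?thesis by (rule H.reachable_adj_trans)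
  qed
  have pu1: "pu1 \<rightarrow>\<^sup>*\<^bsub>?H\<^esub> pu1" by (rule H.reachable_refl) (simp add: core_nbhd_uv)
  have q2: "pu1 \<rightarrow>\<^sup>*\<^bsub>?H\<^esub> q2" by (rule step[OF pu1]) (simp_all add: nbrs_eqs core_nbhd_uv)
  have pv: "pu1 \<rightarrow>\<^sup>*\<^bsub>?H\<^esub> pv" by (rule step[OF q2]) (simp_all add: nbrs_eqs core_nbhd_uv)
  have q3: "pu1 \<rightarrow>\<^sup>*\<^bsub>?H\<^esub> q3" by (rule step[OF pv]) (simp_all add: nbrs_eqs core_nbhd_uv)
  have pu2: "pu1 \<rightarrow>\<^sup>*\<^bsub>?H\<^esub> pu2" by (rule step[OF q3]) (simp_all add: nbrs_eqs core_nbhd_uv)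
  have Q: "pu1 \<rightarrow>\<^sup>*\<^bsub>?H\<^esub> q" if "q \<in> Q" for q
    using that by (intro step[OF pu1]) (simp_all add: nbrs_eqs core_nbhd_uv)
  have P: "pu1 \<rightarrow>\<^sup>*\<^bsub>?H\<^esub> p q" if "q \<in> Q" for q
    using that by (intro step[OF Q[OF that]]) (simp_all add: nbrs_Q core_nbhd_uv)
  show "pu1 \<rightarrow>\<^sup>*\<^bsub>?H\<^esub> a" if "a \<in> core_nbhd u v" for a
    using that pu1 q2 pv q3 pu2 Q P unfolding core_nbhd_uv P_eq_image by blast
qed

lemma W_BM_uv: "W_BM u v = 37 / 24"
proof -
  have "core_nbhd u v \<inter> pent u v = pent u v" "core_nbhd u v \<inter> pent v u = pent v u"
    by (auto simp: core_nbhd_def)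
  then show ?thesis
    \<comment> \<open>The pent sets stay folded in the first pass, so that the intersection
      equations apply. The last bracket is then the positive part of -1/8.\<close>
    by (simp add: W_BM_def mass_eqs core_components_uv) (simp add: pent_u pent_v card_P)
qed

section \<open>The Lipschitz map and its transport profit\<close>

context
  fixes x :: "'a \<Rightarrow> real"
  assumes x: "x pu2 = 1" "\<forall>a\<in>{u, pu1, q3}. x a = 0" "\<forall>a\<in>{v, pv, q2} \<union> Q. x a = - 1"
    "\<forall>a\<in>P. x a = - 2"
begin

lemma x_lipschitz: "lipschitz x"
proof (rule lipschitzI)
  fix a b
  assume "(a, b) \<in> parcs G"
  then show "\<bar>x a - x b\<bar> \<le> 1"
    using x unfolding arcs_G E_eq by auto
qed

text \<open>The values sum to 0 over the neighbours of \<open>u\<close> and to -13 over those of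
  \<open>v\<close>. The map gains 1/3 from raising \<open>pu2\<close> to 1 and 6/8 from lowering
  \<open>P\<close> to -2. Both happen within one component, where \<open>W_BM\<close> takes only the
  larger of two totals.\<close>

lemma x_transport_profit: "transport_profit x u v = 13 / 8"
  using x by (simp add: transport_profit_def mass_eqs nbrs_eqs card_P)

end

end

theorem mainTheorem2:
  fixes G :: "'a pair_pre_digraph"
    and u v pu1 pu2 pv q2 q3 :: 'a
    and P Q :: "'a set"
    and p :: "'a \<Rightarrow> 'a"
    and E :: "('a \<times> 'a) set"
    and x :: "'a \<Rightarrow> real"
  assumes "distinct [u, v, pu1, pu2, pv, q2, q3]"
    and "card P = 6" and "card Q = 6" and "P \<inter> Q = {}"
    and "(P \<union> Q) \<inter> {u, v, pu1, pu2, pv, q2, q3} = {}"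
    and "bij_betw p Q P"
    and "pverts G = {u, v, pu1, pu2, pv, q2, q3} \<union> P \<union> Q"
    and "E = {(u, v), (u, pu1), (u, pu2), (v, pv), (pu1, q2), (q2, pv), (pu2, q3), (q3, pv)}
               \<union> (\<Union>q\<in>Q. {(pu1, q), (q, p q), (p q, v)})"
    and "parcs G = E \<union> E\<inverse>"
    and "x pu2 = 1"
    and "\<forall>a\<in>{u, pu1, q3}. x a = 0"
    and "\<forall>a\<in>{v, pv, q2} \<union> Q. x a = - 1"
    and "\<forall>a\<in>P. x a = - 2"
  shows "locally_finite_graph G \<and> 4 < locally_finite_graph.girth G
    \<and> locally_finite_graph.W_BM G u v = 37 / 24
    \<and> locally_finite_graph.lipschitz G x
    \<and> locally_finite_graph.transport_profit G x u v = 13 / 8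
    \<and> (13 / 8 :: real) > 37 / 24
    \<and> locally_finite_graph.transport_profit G x u v > locally_finite_graph.W_BM G u v"
proof -
  interpret BM_counterexample G u v pu1 pu2 pv q2 q3 P Q p E
    by (rule BM_counterexample.intro) fact+
  show ?thesis
    using locally_finite_graph_axioms girth_gt_4 W_BM_uv
      x_lipschitz[OF assms(10-13)] x_transport_profit[OF assms(10-13)]
    by simp
qed

end
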